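(* Suppose $M_1M_0>\kappa_1$ and put $\varrho=1+M_1\tau$. If $$\sigma\ge\frac1{1+\varrho}\qquad\text{and}\qquad \tau\le\frac{\kappa_1}{\sigma M_1(M_1M_0-\kappa_1)},$$ then the scheme with weights $$B\frac{y^{n+1}-y^n}\tau+Ay^n=\varphi^n,\quad n=0,\dots,N_0-1,\quad y^0=u^0,\qquad B=E+\sigma\tau A,\quad A=A^n=C_1^n+D,$$ is $\varrho$-stable in $H$; that is, for $\varphi^n=0$ one has $\|y^{n+1}\|\le\varrho\|y^n\|$, $n=0,\dots,N_0-1$.
   Context: $H$ is a finite-dimensional real Hilbert space (of grid functions) with scalar product $(\cdot,\cdot)$ and norm $\|\cdot\|$; $E$ is the identity. $\tau>0$ is the time step, $N_0\tau=T$. $D$ is a time-independent linear operator with $D=D^*\ge\frac{\kappa_1}{M_0}E$, $\kappa_1>0$, $M_0>0$. $C_1^n$ is a (possibly time-dependent) linear operator on $H$ (discrete convection in nondivergent form) satisfying $|(C_1^ny,y)|\le M_1\|y\|^2$ for all $y\in H$, with a constant $M_1>0$ independent of $n$. $\varrho$-stability in $H$ with respect to the initial data means that the solution of the homogeneous scheme satisfies $\|y^{n+1}\|\le\varrho\|y^n\|$ for all $n$, where $\varrho>0$ and $\varrho^n\le m_1$ with a constant $m_1$ independent of $\tau$ and $n$. *)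

theory Defs
  imports "HOL-Analysis.Analysis"
begin

text \<open>Operators act on a type of class \<open>euclidean_space\<close>, which models the
  finite-dimensional real Hilbert space \<open>H\<close>. Operators that may depend on time are
  sequences \<open>A n\<close> indexed by the time level. All of them are plain functions; linearity is
  a separate hypothesis, expressed by the library predicate \<open>linear\<close>.\<close>

definition operator_le :: "('a::euclidean_space \<Rightarrow> 'a) \<Rightarrow> ('a \<Rightarrow> 'a) \<Rightarrow> bool"
  where "operator_le P Q \<longleftrightarrow> (\<forall>y. P y \<bullet> y \<le> Q y \<bullet> y)"

text \<open>The sequence \<open>y\<close> is a solution of the two-level scheme in canonical form
  \<open>B (y (n + 1) - y n) / \<tau> + A (y n) = \<phi> n\<close>, \<open>y 0 = u0\<close>; only the values \<open>y 0\<close> to \<open>y N0\<close>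
  are constrained.\<close>

definition two_level_solution ::
  "real \<Rightarrow> nat \<Rightarrow> (nat \<Rightarrow> 'a \<Rightarrow> 'a) \<Rightarrow> (nat \<Rightarrow> 'a \<Rightarrow> 'a) \<Rightarrow> (nat \<Rightarrow> 'a) \<Rightarrow> 'a
    \<Rightarrow> (nat \<Rightarrow> 'a::euclidean_space) \<Rightarrow> bool"
  where "two_level_solution \<tau> N0 B A \<phi> u0 y \<longleftrightarrow>
    y 0 = u0 \<and> (\<forall>n<N0. B n ((y (Suc n) - y n) /\<^sub>R \<tau>) + A n (y n) = \<phi> n)"

definition weighted_op ::
  "real \<Rightarrow> real \<Rightarrow> (nat \<Rightarrow> 'a \<Rightarrow> 'a) \<Rightarrow> nat \<Rightarrow> 'a \<Rightarrow> 'a::euclidean_space"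
  where "weighted_op \<sigma> \<tau> A n v = v + (\<sigma> * \<tau>) *\<^sub>R A n v"

text \<open>\<open>\<rho>\<close>-stability in \<open>H\<close> with respect to the initial data. The bound \<open>m1\<close> on the powers
  of \<open>\<rho>\<close> is a parameter, so that its independence of \<open>\<tau>\<close> and \<open>n\<close> can be expressed by
  the order of quantifiers where the predicate is used.\<close>

definition rho_stable ::
  "real \<Rightarrow> real \<Rightarrow> real \<Rightarrow> nat \<Rightarrow> (nat \<Rightarrow> 'a \<Rightarrow> 'a) \<Rightarrow> (nat \<Rightarrow> 'a \<Rightarrow> 'a::euclidean_space) \<Rightarrow> bool"
  where "rho_stable m1 \<rho> \<tau> N0 B A \<longleftrightarrow>
    0 < \<rho> \<and> (\<forall>n\<le>N0. \<rho> ^ n \<le> m1) \<and>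
    (\<forall>u0 y. two_level_solution \<tau> N0 B A (\<lambda>n. 0) u0 y \<longrightarrow>
      (\<forall>n<N0. norm (y (Suc n)) \<le> \<rho> * norm (y n)))"

end

(* Put v = (y^{n+1} - y^n) / tau and w = sigma y^{n+1} + (1 - sigma) y^n. The homogeneous scheme
   reads v = - A w, and (A w, w) >= - mu |w|^2 with mu = M1 - kappa1 / M0 > 0, so
   (w, v - mu w) <= 0. Both factors are combinations of y^{n+1} and y^n, and the inequality says
   that y^{n+1} lies in the ball whose diameter joins - p y^n to q y^n, where
   p = (1 - sigma) / sigma and q = 1 + tau mu / (1 - sigma tau mu). Hence
   |y^{n+1}| <= max(|p|, |q|) |y^n|. The bound on sigma gives |p| <= rho, and the bound on tau
   gives q <= rho. *)

theory Submission
  imports Defs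
begin

text \<open>Completing the square about the midpoint \<open>?c\<close> of the diameter turns the
  sign condition into a ball of radius \<open>\<bar>p + q\<bar> / 2 * norm y\<close>. The farthest
  point of this ball from the origin lies on the line through the centre.\<close>

lemma norm_le_of_diameter:
  fixes y z :: "'a::real_inner"
  assumes ball: "(z + p *\<^sub>R y) \<bullet> (z - q *\<^sub>R y) \<le> 0"
    and p: "\<bar>p\<bar> \<le> r" and q: "\<bar>q\<bar> \<le> r"
  shows "norm z \<le> r * norm y"
proof -
  let ?c = "((q - p) / 2) *\<^sub>R y"
  have "(norm (z - ?c))\<^sup>2 = (z + p *\<^sub>R y) \<bullet> (z - q *\<^sub>R y) + (\<bar>p + q\<bar> / 2 * norm y)\<^sup>2"
    unfolding power_mult_distrib power2_norm_eq_inner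
    by (simp add: inner_simps inner_commute power2_eq_square field_simps)
  then have "(norm (z - ?c))\<^sup>2 \<le> (\<bar>p + q\<bar> / 2 * norm y)\<^sup>2"
    using ball by simp
  then have "norm (z - ?c) \<le> \<bar>p + q\<bar> / 2 * norm y"
    by (rule power2_le_imp_le) simp
  moreover have "norm z \<le> norm ?c + norm (z - ?c)"
    using norm_triangle_ineq[of ?c "z - ?c"] by simp
  ultimately have "norm z \<le> (\<bar>q - p\<bar> / 2 + \<bar>p + q\<bar> / 2) * norm y"
    by (simp add: distrib_right)
  also have "\<dots> \<le> r * norm y"
  proof (rule mult_right_mono)
    \<comment> \<open>The left side is twice the larger of \<open>\<bar>p\<bar>\<close> and
      \<open>\<bar>q\<bar>\<close>.\<close>
    have "\<bar>q - p\<bar> + \<bar>p + q\<bar> \<le> 2 * r" using p q by linarith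
    then show "\<bar>q - p\<bar> / 2 + \<bar>p + q\<bar> / 2 \<le> r" by (simp add: field_simps)
  qed simp
  finally show ?thesis .
qed

text \<open>One time step with the operator frozen. The ends of the diameter are growth factors of
  the scalar scheme: A = -\<mu> gives the factor
  \<open>1 + \<tau> * \<mu> / (1 - \<sigma> * \<tau> * \<mu>)\<close>, and A tending to infinity
  gives \<open>- (1 - \<sigma>) / \<sigma>\<close>.\<close>

lemma weighted_step_norm_le:
  fixes A :: "'a::real_inner \<Rightarrow> 'a"
  assumes lin: "linear A" and lower: "\<And>w. - \<mu> * (norm w)\<^sup>2 \<le> A w \<bullet> w"
    and pos: "0 < \<tau>" "0 \<le> \<mu>" "0 < \<sigma>" and small: "\<sigma> * \<tau> * \<mu> < 1"
    and step: "v + (\<sigma> * \<tau>) *\<^sub>R A v + A y = 0"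
    and p: "\<bar>(1 - \<sigma>) / \<sigma>\<bar> \<le> \<rho>" and q: "1 + \<tau> * \<mu> / (1 - \<sigma> * \<tau> * \<mu>) \<le> \<rho>"
  shows "norm (y + \<tau> *\<^sub>R v) \<le> \<rho> * norm y"
proof (rule norm_le_of_diameter)
  let ?d = "1 - \<sigma> * \<tau> * \<mu>"
  define w where "w = y + (\<sigma> * \<tau>) *\<^sub>R v"
  have d: "?d > 0" using small by simp
  \<comment> \<open>Linearity merges the implicit and the explicit term: \<open>A w\<close> is
    \<open>A y\<close> plus \<open>\<sigma> * \<tau>\<close> times \<open>A v\<close>.\<close>
  have "A w = - v"
    using step by (simp add: w_def linear_add[OF lin] linear_scale[OF lin] eq_neg_iff_add_eq_0 ac_simps)
  then have "w \<bullet> (v - \<mu> *\<^sub>R w) \<le> 0"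
    using lower[of w] by (simp add: inner_simps inner_commute power2_norm_eq_inner)
  moreover have "y + \<tau> *\<^sub>R v + ((1 - \<sigma>) / \<sigma>) *\<^sub>R y = (1 / \<sigma>) *\<^sub>R w"
  proof -
    have "y + \<tau> *\<^sub>R v + ((1 - \<sigma>) / \<sigma>) *\<^sub>R y = (1 + (1 - \<sigma>) / \<sigma>) *\<^sub>R y + \<tau> *\<^sub>R v"
      by (simp add: scaleR_add_left)
    also have "1 + (1 - \<sigma>) / \<sigma> = 1 / \<sigma>"
      using pos by (simp add: field_simps)
    finally show ?thesis
      using pos by (simp add: w_def scaleR_add_right)
  qed
  \<comment> \<open>Both factors are positive multiples of \<open>w\<close> and
    \<open>v - \<mu> *\<^sub>R w\<close>, so the sign of the inner product carries over.\<close>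
  moreover have "y + \<tau> *\<^sub>R v - (1 + \<tau> * \<mu> / ?d) *\<^sub>R y = (\<tau> / ?d) *\<^sub>R (v - \<mu> *\<^sub>R w)"
  proof -
    have "v - \<mu> *\<^sub>R w = ?d *\<^sub>R v - \<mu> *\<^sub>R y"
      by (simp add: w_def algebra_simps)
    then have "(\<tau> / ?d) *\<^sub>R (v - \<mu> *\<^sub>R w) = (\<tau> / ?d * ?d) *\<^sub>R v - (\<tau> * \<mu> / ?d) *\<^sub>R y"
      by (simp only: scaleR_diff_right scaleR_scaleR times_divide_eq_left)
    also have "\<tau> / ?d * ?d = \<tau>"
      using d by simp
    finally show ?thesis
      by (simp add: scaleR_add_left)
  qed
  ultimately show "(y + \<tau> *\<^sub>R v + ((1 - \<sigma>) / \<sigma>) *\<^sub>R y) \<bullet> (y + \<tau> *\<^sub>R v - (1 + \<tau> * \<mu> / ?d) *\<^sub>R y) \<le> 0"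
    using pos d by (simp add: mult_nonneg_nonpos divide_nonpos_pos)
  show "\<bar>(1 - \<sigma>) / \<sigma>\<bar> \<le> \<rho>" by (rule p)
  have "0 \<le> \<tau> * \<mu> / ?d" using pos d by simp
  then show "\<bar>1 + \<tau> * \<mu> / ?d\<bar> \<le> \<rho>" using q by linarith
qed

lemma power_one_plus_le_exp:
  fixes a :: real
  assumes "0 \<le> a"
  shows "(1 + a) ^ n \<le> exp (real n * a)"
proof -
  have "(1 + a) ^ n \<le> exp a ^ n"
    using assms by (intro power_mono exp_ge_add_one_self) auto
  then show ?thesis by (simp add: exp_of_nat_mult)
qed

theorem theorem18:
  fixes D :: "'a::euclidean_space \<Rightarrow> 'a"
    and \<kappa>1 M0 M1 T :: real
  assumes "0 < \<kappa>1" and "0 < M0" and "0 < M1"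
    and "linear D" and "adjoint D = D"
    and "operator_le (\<lambda>y. (\<kappa>1 / M0) *\<^sub>R y) D"
    and "M1 * M0 > \<kappa>1"
  shows "\<exists>m1. \<forall>(\<tau>::real) (N0::nat) (\<sigma>::real) (\<rho>::real)
      (C1 :: nat \<Rightarrow> 'a \<Rightarrow> 'a) (A :: nat \<Rightarrow> 'a \<Rightarrow> 'a).
    0 < \<tau> \<longrightarrow> real N0 * \<tau> = T \<longrightarrow>
    (\<forall>n<N0. linear (C1 n) \<and> (\<forall>y. \<bar>C1 n y \<bullet> y\<bar> \<le> M1 * (norm y)\<^sup>2)) \<longrightarrow>
    A = (\<lambda>n y. C1 n y + D y) \<longrightarrow>
    \<rho> = 1 + M1 * \<tau> \<longrightarrow>
    \<sigma> \<ge> 1 / (1 + \<rho>) \<longrightarrow>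
    \<tau> \<le> \<kappa>1 / (\<sigma> * M1 * (M1 * M0 - \<kappa>1)) \<longrightarrow>
    rho_stable m1 \<rho> \<tau> N0 (weighted_op \<sigma> \<tau> A) A"
\<comment> \<open>Compounding the growth \<open>1 + M1 * \<tau>\<close> over \<open>N0\<close> steps
  of total length \<open>T\<close> stays below this exponential, which involves only data fixed
  before \<tau>.\<close>
proof (intro exI[of _ "exp (M1 * T)"] allI impI)
  fix \<tau> :: real and N0 :: nat and \<sigma> \<rho> :: real and C1 A :: "nat \<Rightarrow> 'a \<Rightarrow> 'a"
  assume \<tau>: "0 < \<tau>" and T: "real N0 * \<tau> = T"
    and C1: "\<forall>n<N0. linear (C1 n) \<and> (\<forall>y. \<bar>C1 n y \<bullet> y\<bar> \<le> M1 * (norm y)\<^sup>2)"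
    and A: "A = (\<lambda>n y. C1 n y + D y)" and \<rho>: "\<rho> = 1 + M1 * \<tau>"
    and \<sigma>: "\<sigma> \<ge> 1 / (1 + \<rho>)"
    and step_bound: "\<tau> \<le> \<kappa>1 / (\<sigma> * M1 * (M1 * M0 - \<kappa>1))"
  define \<mu> where "\<mu> = M1 - \<kappa>1 / M0"
  have \<mu>: "0 < \<mu>" "\<mu> < M1"
    using assms(1,2,7) by (simp_all add: \<mu>_def field_simps)
  have \<rho>_ge: "1 < \<rho>" using \<rho> \<tau> assms(3) by simp
  have \<sigma>_pos: "0 < \<sigma>"
    using \<sigma> \<rho>_ge by (smt (verit) divide_pos_pos)
  have "\<tau> * (\<sigma> * M1 * (M1 * M0 - \<kappa>1)) \<le> \<kappa>1"
    using step_bound \<sigma>_pos assms(3,7) by (simp add: pos_le_divide_eq)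
  moreover have "\<kappa>1 = M0 * (M1 - \<mu>)" and "M1 * M0 - \<kappa>1 = M0 * \<mu>"
    using assms(2) by (simp_all add: \<mu>_def field_simps)
  ultimately have "M0 * (\<tau> * \<sigma> * M1 * \<mu>) \<le> M0 * (M1 - \<mu>)"
    by (simp add: ac_simps)
  then have "\<tau> * \<sigma> * M1 * \<mu> \<le> M1 - \<mu>"
    using assms(2) by (simp only: mult_le_cancel_left_pos)
  then have "\<mu> \<le> M1 * (1 - \<sigma> * \<tau> * \<mu>)"
    by (simp add: algebra_simps)
  \<comment> \<open>A positive \<mu> lies below \<open>M1\<close> times this gap, so the gap itself
    is positive: the step bound also keeps the denominator of \<open>q\<close> away from
    zero.\<close>
  moreover from this have small: "\<sigma> * \<tau> * \<mu> < 1"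
    using \<mu> assms(3) by (smt (verit) zero_less_mult_pos)
  ultimately have "\<mu> / (1 - \<sigma> * \<tau> * \<mu>) \<le> M1"
    by (simp add: pos_divide_le_eq)
  then have q: "1 + \<tau> * \<mu> / (1 - \<sigma> * \<tau> * \<mu>) \<le> \<rho>"
    using mult_left_mono[of "\<mu> / (1 - \<sigma> * \<tau> * \<mu>)" M1 \<tau>] \<tau> by (simp add: \<rho> mult.commute)
  have "1 \<le> \<sigma> + \<sigma> * \<rho>"
    using \<sigma> \<rho>_ge by (simp add: pos_divide_le_eq distrib_left)
  \<comment> \<open>This covers weights above 1, where \<open>\<bar>1 - \<sigma>\<bar>\<close> is
    \<open>\<sigma> - 1\<close>; the previous inequality covers the others.\<close>
  moreover have "\<sigma> \<le> \<sigma> * \<rho>"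
    using \<sigma>_pos \<rho>_ge by simp
  ultimately have "\<bar>1 - \<sigma>\<bar> \<le> \<sigma> * \<rho>"
    by linarith
  then have p: "\<bar>(1 - \<sigma>) / \<sigma>\<bar> \<le> \<rho>"
    using \<sigma>_pos by (simp add: pos_divide_le_eq mult.commute)
  have pow: "\<rho> ^ n \<le> exp (M1 * T)" if "n \<le> N0" for n
  proof -
    have "\<rho> ^ n \<le> \<rho> ^ N0"
      using that \<rho>_ge by (intro power_increasing) auto
    also have "\<dots> \<le> exp (real N0 * (M1 * \<tau>))"
      unfolding \<rho> using \<tau> assms(3) by (intro power_one_plus_le_exp) simp
    also have "real N0 * (M1 * \<tau>) = M1 * T"
      by (simp add: T[symmetric] ac_simps)
    finally show ?thesis .
  qed
  have "norm (y (Suc n)) \<le> \<rho> * norm (y n)"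
    if sol: "two_level_solution \<tau> N0 (weighted_op \<sigma> \<tau> A) A (\<lambda>n. 0) u0 y" and n: "n < N0"
    for u0 y n
  proof -
    let ?v = "(y (Suc n) - y n) /\<^sub>R \<tau>"
    have "norm (y n + \<tau> *\<^sub>R ?v) \<le> \<rho> * norm (y n)"
    proof (rule weighted_step_norm_le[OF _ _ \<tau> _ \<sigma>_pos small _ p q])
      show "linear (A n)"
        unfolding A using C1 n assms(4) by (intro linear_compose_add) auto
      show "- \<mu> * (norm w)\<^sup>2 \<le> A n w \<bullet> w" for w
      proof -
        \<comment> \<open>Convection can lower the quadratic form by at most \<open>M1\<close>,
          diffusion gives back \<open>\<kappa>1 / M0\<close>, and the net loss is \<mu>.\<close>
        have "- (M1 * (norm w)\<^sup>2) \<le> C1 n w \<bullet> w"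
          using C1 n by (meson abs_le_D2 minus_le_iff)
        moreover have "\<kappa>1 / M0 * (norm w)\<^sup>2 \<le> D w \<bullet> w"
          using assms(6) by (simp add: operator_le_def power2_norm_eq_inner)
        ultimately show ?thesis
          by (simp add: A \<mu>_def inner_add_left left_diff_distrib)
      qed
      show "?v + (\<sigma> * \<tau>) *\<^sub>R A n ?v + A n (y n) = 0"
        using sol n by (simp add: two_level_solution_def weighted_op_def)
    qed (use \<mu> in simp)
    then show ?thesis using \<tau> by simp
  qed
  then show "rho_stable (exp (M1 * T)) \<rho> \<tau> N0 (weighted_op \<sigma> \<tau> A) A"
    using \<rho>_ge pow by (auto simp: rho_stable_def)
qed

end
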